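(* Let $P \subseteq \mathbb{R}^d$ be a rational polytope. Then $P$ is semi-reflexive if and only if $L_{P^\circ}(s) = L_{P^\circ}(\lceil s \rceil)$ for all real $s \ge 0$.
   Context: $P^\circ$ denotes the relative interior of $P$ (its interior when $P$ is full-dimensional). For a set $Q \subseteq \mathbb{R}^d$ and real $s > 0$, let $L_Q(s) = \#(sQ \cap \mathbb{Z}^d)$, where $sQ = \{sx \mid x \in Q\}$ and $\#$ denotes cardinality; by convention $L_Q(0) = 1$. A polytope $P$ is called semi-reflexive if $P$ is rational (all vertices have rational coordinates) and $L_P(s) = L_P(\lfloor s \rfloor)$ for all real $s \ge 0$. *)

theory Defs
  imports "HOL-Analysis.Analysis"
begin

definition integer_points :: "(real ^ 'd) set" where
  "integer_points = {z. \<forall>i. z $ i \<in> \<int>}"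

(* For nonempty Q the value 1 at s = 0 agrees with the number of integer points of 0 Q = {0}.
   The counted set is finite for bounded Q; for unbounded Q, card may return 0 for an
   infinite set. *)
definition lattice_count :: "(real ^ 'd) set \<Rightarrow> real \<Rightarrow> nat" where
  "lattice_count Q s =
     (if s = 0 then 1 else card ((\<lambda>x. s *\<^sub>R x) ` Q \<inter> integer_points))"

definition rational_polytope :: "(real ^ 'd) set \<Rightarrow> bool" where
  "rational_polytope P \<longleftrightarrow>
     polytope P \<and> (\<forall>v. v extreme_point_of P \<longrightarrow> (\<forall>i. v $ i \<in> \<rat>))"

definition semi_reflexive :: "(real ^ 'd) set \<Rightarrow> bool" where
  "semi_reflexive P \<longleftrightarrow>
     rational_polytope P \<and>
     (\<forall>s::real. s \<ge> 0 \<longrightarrow> lattice_count P s = lattice_count P (of_int \<lfloor>s\<rfloor>))"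

end

(* Write P as an intersection of halfspaces a_h x <= b_h within its affine hull, so that ri P is given by
   the strict inequalities. Either of the two counting conditions forces 0 in P: for the condition
   on ri P, otherwise some rational point y of P is tight only for constraints with b_h < 0, and for
   n y integral the point n y lies in s ri P for s slightly below n, but not in n ri P, while no
   lattice point of n ri P is missing from s ri P.
   Once 0 is in P the dilates increase with s, so equal counts mean equal sets, and both
   conditions say that the gauge of P is integral at lattice points: of the cone over P for
   semi-reflexivity, of the relative interior of that cone for the condition on ri P. The latter
   implies the former because the gauge is piecewise linear. *)
theory Submission
  imports Defs
begin

section \<open>Integer points and common denominators\<close>

lemma finite_integer_points_bounded:
  assumes "bounded S"
  shows "finite (S \<inter> integer_points)"
proof -
  obtain B where B: "\<And>x. x \<in> S \<Longrightarrow> norm x \<le> B"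
    using assms bounded_iff by blast
  let ?A = "{k::real. k \<in> \<int> \<and> \<bar>k\<bar> \<le> B}"
  have "vec_nth ` (S \<inter> integer_points) \<subseteq> (UNIV \<rightarrow>\<^sub>E ?A)"
    using B component_le_norm_cart order_trans
    by (fastforce simp: integer_points_def)
  moreover have "finite (UNIV \<rightarrow>\<^sub>E ?A :: ('a \<Rightarrow> real) set)"
    by (intro finite_PiE finite_abs_int_segment) auto
  ultimately have "finite (vec_nth ` (S \<inter> integer_points))"
    by (rule finite_subset)
  then show ?thesis
    by (rule finite_imageD) (simp add: inj_on_def vec_eq_iff)
qed

lemma lattice_set_finite:
  "bounded Q \<Longrightarrow> finite ((\<lambda>x. s *\<^sub>R x) ` Q \<inter> integer_points)"
  by (simp add: bounded_scaling finite_integer_points_bounded)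

lemma integer_points_small_norm:
  assumes "x \<in> integer_points" "norm x < 1"
  shows "x = 0"
proof -
  have "x $ i = 0" for i
  proof -
    have "\<bar>x $ i\<bar> < 1"
      using component_le_norm_cart[of x i] assms(2) by linarith
    then show ?thesis
      using assms(1) Ints_nonzero_abs_less1 by (auto simp: integer_points_def)
  qed
  then show ?thesis by (simp add: vec_eq_iff)
qed

lemma integer_points_add:
  "x \<in> integer_points \<Longrightarrow> y \<in> integer_points \<Longrightarrow> x + y \<in> integer_points"
  by (simp add: integer_points_def)

lemma integer_points_scale_nat:
  "x \<in> integer_points \<Longrightarrow> of_nat n *\<^sub>R x \<in> integer_points"
  by (simp add: integer_points_def)

lemma zero_integer_points: "0 \<in> integer_points"
  by (simp add: integer_points_def)

lemma rational_vector_scale_integer: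
  fixes y :: "real ^ 'd"
  assumes "\<And>i. y $ i \<in> \<rat>"
  obtains n :: nat where "n > 0" "of_nat n *\<^sub>R y \<in> integer_points"
proof -
  have "\<exists>n::nat. n > 0 \<and> real n * y $ i \<in> \<int>" for i
  proof -
    obtain p q :: int where "q > 0" "y $ i = of_int p / of_int q"
      using assms[of i] by (metis Rats_cases')
    then have "real (nat q) * y $ i = of_int p" by simp
    then show ?thesis using \<open>q > 0\<close> by (metis Ints_of_int zero_less_nat_eq)
  qed
  then obtain n where n: "\<And>i. n i > (0::nat)" "\<And>i. real (n i) * y $ i \<in> \<int>"
    by metis
  let ?N = "\<Prod>i\<in>UNIV. n i"
  show thesis
  proof
    show "?N > 0" using n(1) by (simp add: prod_pos)
    have "real ?N * y $ i \<in> \<int>" for i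
    proof -
      have "?N = n i * (\<Prod>j\<in>UNIV - {i}. n j)" by (simp add: prod.remove)
      then have "real ?N * y $ i = real (\<Prod>j\<in>UNIV - {i}. n j) * (real (n i) * y $ i)"
        by (simp only: of_nat_mult mult_ac)
      then show ?thesis using n(2)[of i] by (metis Ints_mult Ints_of_nat)
    qed
    then show "real ?N *\<^sub>R y \<in> integer_points" by (simp add: integer_points_def)
  qed
qed

section \<open>Halfspace descriptions and rational points of a polytope\<close>

text \<open>The family is taken minimal relative to the affine hull: a redundant halfspace whose
  boundary contains all of \<open>P\<close> would make the strict inequalities describe the empty
  set instead of the relative interior.\<close>

lemma polyhedron_halfspaces:
  fixes P :: "'a::euclidean_space set"
  assumes "polyhedron P"
  obtains F :: "'a set set" and a b where "finite F"
    and "\<And>x. x \<in> P \<longleftrightarrow> x \<in> affine hull P \<and> (\<forall>h\<in>F. a h \<bullet> x \<le> b h)"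
    and "\<And>x. x \<in> rel_interior P \<longleftrightarrow> x \<in> affine hull P \<and> (\<forall>h\<in>F. a h \<bullet> x < b h)"
proof -
  obtain F where F: "finite F" "P = affine hull P \<inter> \<Inter>F"
      "\<forall>h\<in>F. \<exists>a b. a \<noteq> 0 \<and> h = {x. a \<bullet> x \<le> b}"
      "\<And>F'. F' \<subset> F \<Longrightarrow> P \<subset> affine hull P \<inter> \<Inter>F'"
    using assms unfolding polyhedron_Int_affine_minimal by meson
  then obtain a b where ab: "\<And>h. h \<in> F \<Longrightarrow> a h \<noteq> 0 \<and> h = {x. a h \<bullet> x \<le> b h}"
    by metis
  have mem: "x \<in> h \<longleftrightarrow> a h \<bullet> x \<le> b h" if "h \<in> F" for x h
    using ab[OF that] by blast
  have P: "x \<in> P \<longleftrightarrow> x \<in> affine hull P \<and> (\<forall>h\<in>F. a h \<bullet> x \<le> b h)" for x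
    by (subst F(2)) (use mem in blast)
  have "rel_interior P = {x \<in> P. \<forall>h\<in>F. a h \<bullet> x < b h}"
    using rel_interior_polyhedron_explicit[OF F(1,2) ab F(4)] .
  then have "x \<in> rel_interior P \<longleftrightarrow> x \<in> affine hull P \<and> (\<forall>h\<in>F. a h \<bullet> x < b h)" for x
    using P[of x] less_imp_le by auto
  with F(1) P show thesis by (rule that)
qed

text \<open>The slack of a convex combination is the weighted sum of the slacks of its points. These
  are nonnegative and the weights positive, so the sum vanishes only if every slack does.\<close>

lemma supporting_sum_eq_iff:
  fixes a :: "'a::real_inner" and c :: "'a \<Rightarrow> real"
  assumes "finite W" "\<And>v. v \<in> W \<Longrightarrow> c v > 0" "sum c W = 1"
    and "\<And>v. v \<in> W \<Longrightarrow> a \<bullet> v \<le> b"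
  shows "a \<bullet> (\<Sum>v\<in>W. c v *\<^sub>R v) = b \<longleftrightarrow> (\<forall>v\<in>W. a \<bullet> v = b)"
proof -
  have "b - a \<bullet> (\<Sum>v\<in>W. c v *\<^sub>R v) = b * sum c W - a \<bullet> (\<Sum>v\<in>W. c v *\<^sub>R v)"
    using assms(3) by simp
  also have "\<dots> = (\<Sum>v\<in>W. c v * (b - a \<bullet> v))"
    by (simp add: inner_sum_right sum_distrib_left algebra_simps sum_subtractf)
  finally have "a \<bullet> (\<Sum>v\<in>W. c v *\<^sub>R v) = b \<longleftrightarrow> (\<Sum>v\<in>W. c v * (b - a \<bullet> v)) = 0"
    by linarith
  also have "\<dots> \<longleftrightarrow> (\<forall>v\<in>W. c v * (b - a \<bullet> v) = 0)"
    using assms by (intro sum_nonneg_eq_0_iff) (auto simp: less_imp_le)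
  also have "\<dots> \<longleftrightarrow> (\<forall>v\<in>W. a \<bullet> v = b)"
    using assms(2) by fastforce
  finally show ?thesis .
qed

text \<open>Take for \<open>y\<close> the barycentre of the extreme points that carry positive
  weight in a convex combination representing \<open>u\<close>. By
  \<open>supporting_sum_eq_iff\<close>, a valid inequality is tight at \<open>y\<close>, and
  likewise at \<open>u\<close>, exactly if it is tight at all those extreme points.\<close>

lemma rational_point_in_minimal_face:
  fixes P :: "(real ^ 'd) set"
  assumes P: "rational_polytope P" and u: "u \<in> P"
  obtains y where "y \<in> P" "\<And>i. y $ i \<in> \<rat>"
    "\<And>a b. (\<And>x. x \<in> P \<Longrightarrow> a \<bullet> x \<le> b) \<Longrightarrow> a \<bullet> y = b \<longleftrightarrow> a \<bullet> u = b"
proof -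
  let ?E = "{v. v extreme_point_of P}"
  have poly: "polytope P" and rat: "\<And>v i. v \<in> ?E \<Longrightarrow> v $ i \<in> \<rat>"
    using P by (auto simp: rational_polytope_def)
  have fin: "finite ?E"
    using poly unfolding polytope_def
    by (metis extreme_points_of_convex_hull finite_subset)
  have "P = convex hull ?E"
    using poly by (intro Krein_Milman_Minkowski polytope_imp_compact polytope_imp_convex)
  then have "u \<in> convex hull ?E" using u by simp
  then obtain c where c: "\<And>v. v \<in> ?E \<Longrightarrow> c v \<ge> 0" "sum c ?E = 1" "(\<Sum>v\<in>?E. c v *\<^sub>R v) = u"
    unfolding convex_hull_finite[OF fin] by auto
  define W where "W = {v \<in> ?E. c v > 0}"
  have W: "finite W" "W \<subseteq> ?E" using fin by (auto simp: W_def)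
  have c0: "c v = 0" if "v \<in> ?E - W" for v
    using that c(1)[of v] by (auto simp: W_def)
  have sumW: "sum c W = 1"
    using sum.mono_neutral_left[OF fin W(2), of c] c0 c(2) by simp
  have uW: "(\<Sum>v\<in>W. c v *\<^sub>R v) = u"
    using sum.mono_neutral_left[OF fin W(2), of "\<lambda>v. c v *\<^sub>R v"] c0 c(3) by simp
  have "W \<noteq> {}" using sumW by auto
  \<comment> \<open>Equal weights are positive and rational, whereas the weights \<open>c\<close>
    representing \<open>u\<close> may be irrational.\<close>
  define k where "k = inverse (real (card W))"
  have k: "k > 0" "(\<Sum>v\<in>W. k) = 1"
    using \<open>W \<noteq> {}\<close> W(1) by (simp_all add: k_def card_gt_0_iff)
  define y where "y = (\<Sum>v\<in>W. k *\<^sub>R v)"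
  have WP: "W \<subseteq> P" using W(2) by (auto simp: extreme_point_of_def)
  show thesis
  proof
    show "y \<in> P" unfolding y_def
      using WP k W(1) poly
      by (intro convex_sum) (auto simp: polytope_imp_convex)
    have "k \<in> \<rat>" by (simp add: k_def)
    then show "y $ i \<in> \<rat>" for i
      using rat W(2) by (auto simp: y_def intro!: Rats_sum Rats_mult)
    fix a b assume ab: "\<And>x. x \<in> P \<Longrightarrow> a \<bullet> x \<le> b"
    have "a \<bullet> y = b \<longleftrightarrow> (\<forall>v\<in>W. a \<bullet> v = b)"
      unfolding y_def using k W(1) ab WP by (intro supporting_sum_eq_iff) auto
    moreover have "a \<bullet> u = b \<longleftrightarrow> (\<forall>v\<in>W. a \<bullet> v = b)"
      unfolding uW[symmetric] using sumW W(1) ab WP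
      by (intro supporting_sum_eq_iff) (auto simp: W_def)
    ultimately show "a \<bullet> y = b \<longleftrightarrow> a \<bullet> u = b" by simp
  qed
qed

text \<open>A relative interior point \<open>u\<close> is tight for no constraint, and a rational
  point with the same tight constraints is therefore relatively interior too.\<close>

lemma rational_point_in_rel_interior:
  fixes P :: "(real ^ 'd) set"
  assumes P: "rational_polytope P" and "P \<noteq> {}"
  obtains y where "y \<in> rel_interior P" "\<And>i. y $ i \<in> \<rat>"
proof -
  have poly: "polytope P" using P by (simp add: rational_polytope_def)
  obtain F :: "(real ^ 'd) set set" and a b where "finite F" and F:
      "\<And>x. x \<in> P \<longleftrightarrow> x \<in> affine hull P \<and> (\<forall>h\<in>F. a h \<bullet> x \<le> b h)"
      "\<And>x. x \<in> rel_interior P \<longleftrightarrow> x \<in> affine hull P \<and> (\<forall>h\<in>F. a h \<bullet> x < b h)"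
    by (rule polyhedron_halfspaces[OF polytope_imp_polyhedron[OF poly]]) (rule that)
  obtain u where u: "u \<in> rel_interior P"
    using assms(2) rel_interior_eq_empty[OF polytope_imp_convex[OF poly]] by blast
  then have uP: "u \<in> P" using rel_interior_subset by blast
  obtain y where y: "y \<in> P" "\<And>i. y $ i \<in> \<rat>"
    "\<And>a b. (\<And>x. x \<in> P \<Longrightarrow> a \<bullet> x \<le> b) \<Longrightarrow> a \<bullet> y = b \<longleftrightarrow> a \<bullet> u = b"
    using rational_point_in_minimal_face[OF P uP] by metis
  have sup: "a h \<bullet> x \<le> b h" if "h \<in> F" "x \<in> P" for h x
    using that F(1) by blast
  have "a h \<bullet> y < b h" if "h \<in> F" for h
  proof -
    have "a h \<bullet> u < b h" using u F(2) that by blast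
    then show ?thesis using y(3)[OF sup[OF that]] sup[OF that y(1)] by force
  qed
  then have "y \<in> rel_interior P"
    using F(2)[of y] y(1) hull_inc[of y P affine] by blast
  then show thesis using that y(2) by blast
qed

section \<open>Scalings and maxima of affine functions\<close>

lemma zero_mem_affine_of_two_scalings:
  fixes x :: "'a::real_vector"
  assumes "affine V" "(1/s) *\<^sub>R x \<in> V" "(1/t) *\<^sub>R x \<in> V" "s \<noteq> t" "s > 0" "t > 0"
  shows "0 \<in> V"
proof -
  \<comment> \<open>The weights -s/(t-s) and t/(t-s) add up to 1 and cancel the multiples 1/s and
    1/t of \<open>x\<close>.\<close>
  have "(1 - t/(t-s)) *\<^sub>R ((1/s) *\<^sub>R x) + (t/(t-s)) *\<^sub>R ((1/t) *\<^sub>R x) \<in> V"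
    using assms by (intro mem_affine) auto
  also have "(1 - t/(t-s)) *\<^sub>R ((1/s) *\<^sub>R x) + (t/(t-s)) *\<^sub>R ((1/t) *\<^sub>R x)
    = ((1 - t/(t-s)) * (1/s) + (t/(t-s)) * (1/t)) *\<^sub>R x"
    by (simp add: scaleR_add_left)
  also have "(1 - t/(t-s)) * (1/s) + (t/(t-s)) * (1/t) = 0"
    using assms(4-6) by (simp add: field_simps)
  finally show ?thesis by simp
qed

lemma mem_scaling_iff:
  fixes x :: "'a::real_vector"
  assumes "s > 0"
  shows "x \<in> (\<lambda>x. s *\<^sub>R x) ` Q \<longleftrightarrow> (1/s) *\<^sub>R x \<in> Q"
  using assms by (auto simp: image_iff intro!: bexI[of _ "(1/s) *\<^sub>R x"])

text \<open>For large \<open>K\<close> the slope decides, and among equal slopes the intercept; so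
  \<open>j\<close> is chosen with maximal slope and, subject to that, maximal intercept.\<close>

lemma eventually_max_affine:
  fixes p q :: "'a \<Rightarrow> real"
  assumes "finite H" "H \<noteq> {}"
  obtains j where "j \<in> H" "\<And>i. i \<in> H \<Longrightarrow> p i \<le> p j"
    "eventually (\<lambda>K::nat. \<forall>i\<in>H. K * p i + q i \<le> K * p j + q j) sequentially"
proof -
  let ?J = "{i \<in> H. p i = Max (p ` H)}"
  have "Max (p ` H) \<in> p ` H" using assms by simp
  then have "?J \<noteq> {}" by force
  then have "Max (q ` ?J) \<in> q ` ?J" using assms(1) by (intro Max_in) auto
  then obtain j where "j \<in> ?J" "q j = Max (q ` ?J)" by force
  then have j: "j \<in> ?J" "\<And>i. i \<in> ?J \<Longrightarrow> q i \<le> q j" using assms(1) by auto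
  have pj: "p i \<le> p j" if "i \<in> H" for i using that j(1) assms(1) by simp
  have "eventually (\<lambda>K::nat. K * p i + q i \<le> K * p j + q j) sequentially" if i: "i \<in> H" for i
  proof (cases "p i = p j")
    case True
    then show ?thesis using j i by auto
  next
    case False
    then have d: "p j - p i > 0" using pj[OF i] by simp
    show ?thesis
      \<comment> \<open>From this \<open>K\<close> on, the gain in slope outweighs the difference of
        the intercepts.\<close>
      using eventually_ge_at_top[of "nat \<lceil>(q i - q j) / (p j - p i)\<rceil>"]
    proof eventually_elim
      case (elim K)
      then have "(q i - q j) / (p j - p i) \<le> real K" by linarith
      then have "q i - q j \<le> real K * (p j - p i)" using d by (simp add: divide_simps)
      then show ?case by (simp add: algebra_simps)
    qed
  qed
  then have "eventually (\<lambda>K::nat. \<forall>i\<in>H. K * p i + q i \<le> K * p j + q j) sequentially"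
    using assms(1) by (simp add: eventually_ball_finite)
  then show thesis using that j(1) pj by blast
qed

section \<open>The ceiling condition and the affine hull\<close>

definition ceiling_condition :: "(real ^ 'd) set \<Rightarrow> bool" where
  "ceiling_condition P \<longleftrightarrow> (\<forall>s::real. s \<ge> 0 \<longrightarrow>
     lattice_count (rel_interior P) s = lattice_count (rel_interior P) (of_int \<lceil>s\<rceil>))"

text \<open>Clearing denominators of a relative interior point gives an integer point at some
  dilation \<open>n\<close>, hence one for every \<open>s\<close> in (n-1, n], where the ceiling is
  constant. All of these lie in one ball, so by pigeonhole a single integer point serves two
  different dilations, and the line through its two rescalings reaches 0.\<close>

lemma ceiling_condition_zero_mem_affine_hull:
  fixes P :: "(real ^ 'd) set"
  assumes P: "rational_polytope P" "P \<noteq> {}" and ceil: "ceiling_condition P"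
  shows "0 \<in> affine hull P"
proof -
  let ?R = "rel_interior P"
  have bdd: "bounded P"
    using P by (simp add: rational_polytope_def polytope_imp_bounded)
  obtain z where z: "z \<in> ?R" "\<And>i. z $ i \<in> \<rat>"
    using rational_point_in_rel_interior[OF P] by metis
  obtain n :: nat where n: "n > 0" "of_nat n *\<^sub>R z \<in> integer_points"
    using rational_vector_scale_integer[of z] z(2) by metis
  have "lattice_count ?R (real n) > 0"
    using n z(1) lattice_set_finite[of ?R "real n"] bdd
      bounded_subset[OF bdd rel_interior_subset]
    by (auto simp: lattice_count_def card_gt_0_iff)
  moreover have "lattice_count ?R s = lattice_count ?R (real n)" if "s \<in> {real n - 1 <.. real n}" for s
  proof -
    have "\<lceil>s\<rceil> = int n" "s \<ge> 0" using that n(1) by (auto simp: ceiling_eq_iff)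
    then show ?thesis using ceil unfolding ceiling_condition_def by (metis of_int_of_nat_eq)
  qed
  ultimately have count: "lattice_count ?R s > 0" if "s \<in> {real n - 1 <.. real n}" for s
    using that by metis
  have ex: "\<exists>x. x \<in> integer_points \<and> x \<in> (\<lambda>x. s *\<^sub>R x) ` ?R" if "s \<in> {real n - 1 <.. real n}" for s
  proof -
    \<comment> \<open>This excludes the conventional value 1 at dilation 0, which would yield no
      integer point.\<close>
    have "s \<noteq> 0" using that n(1) by auto
    then have "card ((\<lambda>x. s *\<^sub>R x) ` ?R \<inter> integer_points) > 0"
      using count[OF that] by (simp add: lattice_count_def)
    then have "(\<lambda>x. s *\<^sub>R x) ` ?R \<inter> integer_points \<noteq> {}" by (metis card.empty less_irrefl)
    then show ?thesis by blast
  qed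
  let ?I = "{real n - 1 <.. real n}"
  obtain f where f: "\<And>s. s \<in> ?I \<Longrightarrow> f s \<in> integer_points \<and> f s \<in> (\<lambda>x. s *\<^sub>R x) ` ?R"
    using ex by metis
  obtain B where B: "B > 0" "\<And>x. x \<in> P \<Longrightarrow> norm x \<le> B"
    using bdd bounded_pos by blast
  have "f ` ?I \<subseteq> cball 0 (real n * B) \<inter> integer_points"
  proof clarify
    fix s assume s: "s \<in> ?I"
    obtain x where x: "x \<in> ?R" "f s = s *\<^sub>R x" using f[OF s] by auto
    have "norm x \<le> B" using x(1) B(2) rel_interior_subset by blast
    then have "\<bar>s\<bar> * norm x \<le> real n * B" using s n(1) by (intro mult_mono) auto
    then show "f s \<in> cball 0 (real n * B) \<inter> integer_points" using f[OF s] x(2) by simp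
  qed
  then have "finite (f ` ?I)"
    using finite_integer_points_bounded[OF bounded_cball] finite_subset by blast
  moreover have "infinite ?I" by (simp add: infinite_Ioc)
  ultimately have "\<not> inj_on f ?I" using finite_imageD by blast
  then obtain s t where st: "s \<in> ?I" "t \<in> ?I" "s \<noteq> t" "f s = f t" by (auto simp: inj_on_def)
  have pos: "s > 0" "t > 0" using st(1,2) n(1) by auto
  have mem: "(1/r) *\<^sub>R f r \<in> affine hull P" if r: "r \<in> ?I" "r > 0" for r
  proof -
    obtain x where "x \<in> ?R" "f r = r *\<^sub>R x" using f[OF r(1)] by auto
    then show ?thesis using r(2) rel_interior_subset hull_subset[of P affine] by auto
  qed
  show ?thesis
    using zero_mem_affine_of_two_scalings[OF affine_affine_hull, of s "f s" P t]
      mem[OF st(1)] mem[OF st(2)] st pos by simp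
qed

section \<open>Dilates described by scaled inequalities\<close>

text \<open>With 0 in the affine hull, the hull is a linear subspace and invariant under nonzero
  scaling, so dilating by \<open>s\<close> > 0 changes only the right-hand sides, from
  \<open>b h\<close> to \<open>s * b h\<close>.\<close>

locale halfspace_polytope =
  fixes P :: "(real ^ 'd) set" and F :: "'i set" and a :: "'i \<Rightarrow> real ^ 'd" and b :: "'i \<Rightarrow> real"
  assumes rational: "rational_polytope P" and nonempty: "P \<noteq> {}"
    and zero_affine: "0 \<in> affine hull P"
    and finite_F: "finite F"
    and mem_P: "\<And>x. x \<in> P \<longleftrightarrow> x \<in> affine hull P \<and> (\<forall>h\<in>F. a h \<bullet> x \<le> b h)"
    and rel_interior_iff: "\<And>x. x \<in> rel_interior P \<longleftrightarrow> x \<in> affine hull P \<and> (\<forall>h\<in>F. a h \<bullet> x < b h)"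
begin

text \<open>For \<open>s\<close> > 0 these are the integer points of the dilate of \<open>P\<close>;
  at \<open>s\<close> = 0 they are those of its recession cone.\<close>

definition closed_points :: "real \<Rightarrow> (real ^ 'd) set" where
  "closed_points s = {x \<in> integer_points \<inter> affine hull P. \<forall>h\<in>F. a h \<bullet> x \<le> s * b h}"

definition inner_points :: "real \<Rightarrow> (real ^ 'd) set" where
  "inner_points s = {x \<in> integer_points \<inter> affine hull P. \<forall>h\<in>F. a h \<bullet> x < s * b h}"

lemma bounded_P: "bounded P"
  using rational by (simp add: rational_polytope_def polytope_imp_bounded)

lemma affine_hull_scale: "x \<in> affine hull P \<Longrightarrow> c *\<^sub>R x \<in> affine hull P"
  using zero_affine affine_hull_span_0 by (metis span_scale)

lemma affine_hull_add: "x \<in> affine hull P \<Longrightarrow> y \<in> affine hull P \<Longrightarrow> x + y \<in> affine hull P"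
  using zero_affine affine_hull_span_0 by (metis span_add)

lemma affine_hull_scale_iff:
  assumes "c \<noteq> 0"
  shows "c *\<^sub>R x \<in> affine hull P \<longleftrightarrow> x \<in> affine hull P"
  using affine_hull_scale[of x c] affine_hull_scale[of "c *\<^sub>R x" "1/c"] assms by auto

lemma scaled_closed:
  "s > 0 \<Longrightarrow> (\<lambda>x. s *\<^sub>R x) ` P \<inter> integer_points = closed_points s"
  by (auto simp: mem_scaling_iff mem_P affine_hull_scale_iff closed_points_def field_simps)

lemma scaled_inner:
  "s > 0 \<Longrightarrow> (\<lambda>x. s *\<^sub>R x) ` rel_interior P \<inter> integer_points = inner_points s"
  by (auto simp: mem_scaling_iff rel_interior_iff affine_hull_scale_iff inner_points_def field_simps)

lemma finite_closed_points: "s > 0 \<Longrightarrow> finite (closed_points s)"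
  using lattice_set_finite[OF bounded_P] scaled_closed by metis

lemma inner_subset_closed: "inner_points s \<subseteq> closed_points s"
  by (force simp: inner_points_def closed_points_def less_imp_le)

lemma finite_inner_points: "s > 0 \<Longrightarrow> finite (inner_points s)"
  using finite_closed_points inner_subset_closed finite_subset by blast

lemma lattice_count_closed: "s > 0 \<Longrightarrow> lattice_count P s = card (closed_points s)"
  by (simp add: lattice_count_def scaled_closed)

lemma lattice_count_inner: "s > 0 \<Longrightarrow> lattice_count (rel_interior P) s = card (inner_points s)"
  by (simp add: lattice_count_def scaled_inner)

lemma card_inner_ceiling:
  assumes "ceiling_condition P" "s > 0"
  shows "card (inner_points s) = card (inner_points (of_int \<lceil>s\<rceil>))"
proof -
  have "lattice_count (rel_interior P) s = lattice_count (rel_interior P) (of_int \<lceil>s\<rceil>)"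
    using assms unfolding ceiling_condition_def by (meson less_imp_le)
  moreover have "real_of_int \<lceil>s\<rceil> > 0" using assms(2) by simp
  ultimately show ?thesis using assms(2) by (simp only: lattice_count_inner)
qed

section \<open>Decreasing the dilation factor, and the origin in \<open>P\<close>\<close>

text \<open>Finitely many strict inequalities, continuous in the dilation factor, survive a small
  decrease of it, whatever the signs of the \<open>b h\<close>.\<close>

lemma eventually_inner_at_left:
  assumes "x \<in> inner_points t"
  shows "eventually (\<lambda>s. x \<in> inner_points s) (at_left t)"
proof -
  have "eventually (\<lambda>s. a h \<bullet> x < s * b h) (at_left t)" if "h \<in> F" for h
  proof -
    have "((\<lambda>s. s * b h) \<longlongrightarrow> t * b h) (at_left t)" by (intro tendsto_intros)
    then show ?thesis
      using assms that by (intro order_tendstoD(1)) (auto simp: inner_points_def)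
  qed
  then have "eventually (\<lambda>s. \<forall>h\<in>F. a h \<bullet> x < s * b h) (at_left t)"
    using finite_F by (simp add: eventually_ball_finite)
  then show ?thesis
    using assms by (auto simp: inner_points_def elim: eventually_mono)
qed

lemma rational_inner_point:
  obtains n :: nat and w where "n > 0" "w \<in> inner_points (real n)"
proof -
  obtain z where z: "z \<in> rel_interior P" "\<And>i. z $ i \<in> \<rat>"
    using rational_point_in_rel_interior[OF rational nonempty] by metis
  obtain n :: nat where n: "n > 0" "of_nat n *\<^sub>R z \<in> integer_points"
    using rational_vector_scale_integer[of z] z(2) by metis
  then have "of_nat n *\<^sub>R z \<in> inner_points (real n)"
    using z(1) scaled_inner[of "real n"] by auto
  then show thesis using that n(1) by blast
qed

text \<open>The entry point into \<open>P\<close> of the ray through a relative interior point lies only on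
  facets separating \<open>0\<close> from \<open>P\<close>.\<close>
lemma visible_boundary_point:
  assumes "0 \<notin> P"
  obtains u where "u \<in> P" "\<exists>h\<in>F. a h \<bullet> u = b h" "\<And>h. h \<in> F \<Longrightarrow> a h \<bullet> u = b h \<Longrightarrow> b h < 0"
proof -
  have conv: "convex P" and cpt: "compact P"
    using rational by (auto simp: rational_polytope_def polytope_imp_convex polytope_imp_compact)
  obtain z where z: "z \<in> rel_interior P"
    using nonempty rel_interior_eq_empty[OF conv] by blast
  then have zP: "z \<in> P" using rel_interior_subset by blast
  have z0: "z \<noteq> 0" using assms zP by auto
  \<comment> \<open>The entry point is \<open>t *\<^sub>R z\<close> for the least \<open>t\<close>
    in this compact set.\<close>
  let ?T = "{t \<in> {0..1}. t *\<^sub>R z \<in> P}"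
  have "?T = {0..1} \<inter> (\<lambda>t. t *\<^sub>R z) -` P" by auto
  moreover have "closed ((\<lambda>t. t *\<^sub>R z) -` P)"
    using cpt by (intro continuous_closed_vimage) (auto simp: compact_imp_closed intro!: continuous_intros)
  ultimately have "compact ?T" by (simp add: compact_Int_closed)
  moreover have "1 \<in> ?T" using zP by simp
  ultimately obtain t where t: "t \<in> ?T" "\<And>r. r \<in> ?T \<Longrightarrow> t \<le> r"
    using compact_attains_inf[of ?T] by blast
  have tpos: "t > 0" using t(1) assms by (cases "t = 0") auto
  have tP: "t *\<^sub>R z \<in> P" using t(1) by simp
  have strict: "a h \<bullet> z < b h" if "h \<in> F" for h using z that rel_interior_iff by blast
  show thesis
  proof
    show "t *\<^sub>R z \<in> P" by (fact tP)
    show "\<exists>h\<in>F. a h \<bullet> (t *\<^sub>R z) = b h"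
    proof (rule ccontr)
      assume "\<not> ?thesis"
      then have less: "a h \<bullet> (t *\<^sub>R z) < b h" if "h \<in> F" for h
        using tP that mem_P by force
      have "eventually (\<lambda>r. a h \<bullet> (r *\<^sub>R z) < b h) (at_left t)" if "h \<in> F" for h
      proof -
        have "((\<lambda>r. a h \<bullet> (r *\<^sub>R z)) \<longlongrightarrow> a h \<bullet> (t *\<^sub>R z)) (at_left t)" by (intro tendsto_intros)
        then show ?thesis using less[OF that] by (rule order_tendstoD(2))
      qed
      then have "eventually (\<lambda>r. \<forall>h\<in>F. a h \<bullet> (r *\<^sub>R z) < b h) (at_left t)"
        using finite_F by (simp add: eventually_ball_finite)
      moreover have "eventually (\<lambda>r. r \<in> {0<..<t}) (at_left t)"
        using tpos by (rule eventually_at_left_real)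
      ultimately have "eventually (\<lambda>r. (\<forall>h\<in>F. a h \<bullet> (r *\<^sub>R z) < b h) \<and> r \<in> {0<..<t}) (at_left t)"
        by eventually_elim auto
      then obtain r where r: "\<forall>h\<in>F. a h \<bullet> (r *\<^sub>R z) < b h" "r \<in> {0<..<t}"
        using eventually_happens[of _ "at_left t"] by (auto simp: trivial_limit_at_left_real)
      have "r *\<^sub>R z \<in> affine hull P" using hull_inc[OF zP] by (rule affine_hull_scale)
      then have "r *\<^sub>R z \<in> P"
        unfolding mem_P[of "r *\<^sub>R z"] using r(1) less_imp_le by blast
      moreover have "r \<in> {0..1}" using r(2) t(1) by auto
      ultimately have "t \<le> r" by (intro t(2)) simp
      then show False using r(2) by simp
    qed
    fix h assume h: "h \<in> F" "a h \<bullet> (t *\<^sub>R z) = b h"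
    have tle: "t \<le> 1" using t(1) by simp
    \<comment> \<open>By tightness the left side is \<open>b h\<close>, so \<open>b h\<close> <
      \<open>t * b h\<close>, which for \<open>t\<close> at most 1 forces \<open>b h\<close> <
      0.\<close>
    have "t * (a h \<bullet> z) < t * b h" using strict[OF h(1)] tpos by simp
    then have "b h * (1 - t) < 0" using h(2) by (simp add: algebra_simps)
    then show "b h < 0" using tle by (simp add: mult_less_0_iff)
  qed
qed

lemma ceiling_condition_zero_mem:
  assumes ceil: "ceiling_condition P"
  shows "0 \<in> P"
proof (rule ccontr)
  assume "0 \<notin> P"
  then obtain u where u: "u \<in> P" "\<exists>h\<in>F. a h \<bullet> u = b h"
      "\<And>h. h \<in> F \<Longrightarrow> a h \<bullet> u = b h \<Longrightarrow> b h < 0"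
    using visible_boundary_point by metis
  \<comment> \<open>Some multiple must be integral, so \<open>u\<close> is replaced by a rational
    point with the same tight constraints.\<close>
  obtain y where y: "y \<in> P" "\<And>i. y $ i \<in> \<rat>"
    "\<And>a b. (\<And>x. x \<in> P \<Longrightarrow> a \<bullet> x \<le> b) \<Longrightarrow> a \<bullet> y = b \<longleftrightarrow> a \<bullet> u = b"
    using rational_point_in_minimal_face[OF rational u(1)] by metis
  have tight: "a h \<bullet> y = b h \<longleftrightarrow> a h \<bullet> u = b h" if "h \<in> F" for h
    using y(3) that mem_P by blast
  obtain n :: nat where n: "n > 0" "of_nat n *\<^sub>R y \<in> integer_points"
    using rational_vector_scale_integer[of y] y(2) by metis
  let ?x = "of_nat n *\<^sub>R y"
  obtain h where "h \<in> F" "a h \<bullet> y = b h" using u(2) tight by blast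
  then have xout: "?x \<notin> inner_points (real n)" by (auto simp: inner_points_def intro!: bexI[of _ h])
  have "eventually (\<lambda>s. a h \<bullet> ?x < s * b h) (at_left (real n))" if h: "h \<in> F" for h
  proof (cases "a h \<bullet> y = b h")
    case True
    \<comment> \<open>Negativity makes \<open>s * b h\<close> grow as \<open>s\<close> drops below
      \<open>n\<close>, so the tight constraint becomes strict.\<close>
    then have "b h < 0" using u(3) tight h by blast
    moreover have "eventually (\<lambda>s. s < real n) (at_left (real n))"
      by (simp add: eventually_at_filter)
    ultimately show ?thesis using True by (auto elim!: eventually_mono)
  next
    case False
    then have "a h \<bullet> y < b h" using y(1) h mem_P by force
    then have "a h \<bullet> ?x < real n * b h" using n(1) by simp
    moreover have "((\<lambda>s. s * b h) \<longlongrightarrow> real n * b h) (at_left (real n))" by (intro tendsto_intros)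
    ultimately show ?thesis by (intro order_tendstoD(1))
  qed
  then have "eventually (\<lambda>s. \<forall>h\<in>F. a h \<bullet> ?x < s * b h) (at_left (real n))"
    using finite_F by (simp add: eventually_ball_finite)
  then have ev1: "eventually (\<lambda>s. ?x \<in> inner_points s) (at_left (real n))"
    using n(2) affine_hull_scale[OF hull_inc[OF y(1)], of "real n"]
    by (auto simp: inner_points_def elim!: eventually_mono)
  \<comment> \<open>Finiteness of the set gives one neighbourhood that works for all its
    points.\<close>
  have ev2: "eventually (\<lambda>s. \<forall>x\<in>inner_points (real n). x \<in> inner_points s) (at_left (real n))"
    using finite_inner_points[of "real n"] n(1) eventually_inner_at_left
    by (simp add: eventually_ball_finite)
  have ev3: "eventually (\<lambda>s. s \<in> {real n - 1<..<real n}) (at_left (real n))"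
    by (rule eventually_at_left_real) simp
  have "eventually (\<lambda>s. ?x \<in> inner_points s \<and> inner_points (real n) \<subseteq> inner_points s
      \<and> s \<in> {real n - 1<..<real n}) (at_left (real n))"
    using ev1 ev2 ev3 by eventually_elim blast
  then obtain s where s: "?x \<in> inner_points s" "inner_points (real n) \<subseteq> inner_points s"
      "s \<in> {real n - 1<..<real n}"
    using eventually_happens[of _ "at_left (real n)"] by (auto simp: trivial_limit_at_left_real)
  have spos: "s > 0" using s(3) n(1) by auto
  have "\<lceil>s\<rceil> = int n" using s(3) by (simp add: ceiling_eq_iff)
  then have "card (inner_points s) = card (inner_points (real n))"
    using card_inner_ceiling[OF ceil spos] by simp
  \<comment> \<open>Equal counts exclude a proper inclusion, yet \<open>?x\<close> lies only in the
    set at \<open>s\<close>.\<close>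
  then have "inner_points (real n) = inner_points s"
    using card_subset_eq[OF finite_inner_points[OF spos] s(2)] by simp
  then show False using s(1) xout by simp
qed

section \<open>Nested dilates: both conditions as equalities of sets\<close>

context
  assumes zero: "0 \<in> P"
begin

lemma b_nonneg: "h \<in> F \<Longrightarrow> b h \<ge> 0"
  using zero mem_P[of 0] by simp

lemma closed_points_mono: "s \<le> t \<Longrightarrow> closed_points s \<subseteq> closed_points t"
  unfolding closed_points_def by (force dest: mult_right_mono[OF _ b_nonneg])

lemma inner_points_mono: "s \<le> t \<Longrightarrow> inner_points s \<subseteq> inner_points t"
  unfolding inner_points_def by (force dest: mult_right_mono[OF _ b_nonneg])

text \<open>Otherwise the whole ray from 0 through \<open>x\<close> would lie in the bounded set
  \<open>P\<close>.\<close>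

lemma recession_trivial:
  assumes x: "x \<in> affine hull P" "\<And>h. h \<in> F \<Longrightarrow> a h \<bullet> x \<le> 0"
  shows "x = 0"
proof (rule ccontr)
  assume "x \<noteq> 0"
  obtain B where B: "B > 0" "\<And>x. x \<in> P \<Longrightarrow> norm x \<le> B"
    using bounded_P bounded_pos by blast
  \<comment> \<open>This factor gives the multiple of \<open>x\<close> norm \<open>B + 1\<close>,
    beyond the bound on \<open>P\<close>.\<close>
  let ?c = "(B + 1) / norm x"
  have "?c *\<^sub>R x \<in> P"
    unfolding mem_P[of "?c *\<^sub>R x"]
  proof (intro conjI ballI affine_hull_scale x(1))
    fix h assume h: "h \<in> F"
    have "?c * (a h \<bullet> x) \<le> 0" using x(2)[OF h] B(1) by (intro mult_nonneg_nonpos) auto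
    then show "a h \<bullet> (?c *\<^sub>R x) \<le> b h" using b_nonneg[OF h] by simp
  qed
  then have "norm (?c *\<^sub>R x) \<le> B" by (rule B(2))
  then show False using \<open>x \<noteq> 0\<close> B(1) by simp
qed

text \<open>This matches the convention that the count at dilation 0 is 1, which semi-reflexivity
  uses whenever \<open>s\<close> < 1.\<close>

lemma closed_points_0: "closed_points 0 = {0}"
  using recession_trivial zero_affine zero_integer_points by (auto simp: closed_points_def)

lemma lattice_count_closed_0: "s \<ge> 0 \<Longrightarrow> lattice_count P s = card (closed_points s)"
  using lattice_count_closed[of s] closed_points_0
  by (cases "s = 0") (auto simp: lattice_count_def)

lemma finite_closed_points_0: "s \<ge> 0 \<Longrightarrow> finite (closed_points s)"
  using finite_closed_points[of s] closed_points_0 by (cases "s = 0") auto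

lemma semi_reflexive_iff_closed_points:
  "semi_reflexive P \<longleftrightarrow> (\<forall>s\<ge>0. closed_points s = closed_points (of_int \<lfloor>s\<rfloor>))"
proof -
  have "lattice_count P s = lattice_count P (of_int \<lfloor>s\<rfloor>) \<longleftrightarrow>
      closed_points s = closed_points (of_int \<lfloor>s\<rfloor>)" if "s \<ge> 0" for s
    using that card_subset_eq[OF finite_closed_points_0[OF that] closed_points_mono[OF of_int_floor_le]]
    by (auto simp: lattice_count_closed_0)
  then show ?thesis using rational by (simp add: semi_reflexive_def)
qed

text \<open>Nested finite sets of equal size coincide. The case \<open>s\<close> = 0 compares a
  value with itself, and the ceiling of a positive \<open>s\<close> is positive, so the convention
  at 0 never enters.\<close>

lemma ceiling_condition_iff_inner_points:
  "ceiling_condition P \<longleftrightarrow> (\<forall>s>0. inner_points s = inner_points (of_int \<lceil>s\<rceil>))"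
proof -
  have "lattice_count (rel_interior P) s = lattice_count (rel_interior P) (of_int \<lceil>s\<rceil>) \<longleftrightarrow>
      inner_points s = inner_points (of_int \<lceil>s\<rceil>)" if "s > 0" for s
  proof -
    have "real_of_int \<lceil>s\<rceil> > 0" using that by simp
    then show ?thesis
      using that card_subset_eq[OF finite_inner_points inner_points_mono[OF le_of_int_ceiling]]
      by (auto simp: lattice_count_inner)
  qed
  then show ?thesis
    unfolding ceiling_condition_def by (metis ceiling_zero of_int_0 order_le_less)
qed

section \<open>Equivalence of the two conditions when 0 lies in \<open>P\<close>\<close>

text \<open>A point strictly inside at the ceiling \<open>n\<close> of \<open>s\<close> is still
  inside at some \<open>t\<close> in (n-1, n). Rounding \<open>t\<close> down puts it in the closed
  dilate at n-1, and n-1 < \<open>s\<close> makes the inequalities strict at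
  \<open>s\<close>.\<close>

lemma semi_reflexive_imp_ceiling_condition:
  assumes "semi_reflexive P"
  shows "ceiling_condition P"
  unfolding ceiling_condition_iff_inner_points
proof (intro allI impI equalityI)
  fix s :: real assume s: "s > 0"
  let ?n = "\<lceil>s\<rceil>"
  show "inner_points s \<subseteq> inner_points (of_int ?n)" by (rule inner_points_mono) simp
  show "inner_points (of_int ?n) \<subseteq> inner_points s"
  proof
    fix x assume x: "x \<in> inner_points (of_int ?n)"
    have "eventually (\<lambda>t. t \<in> {real_of_int ?n - 1<..<of_int ?n}) (at_left (of_int ?n))"
      by (rule eventually_at_left_real) simp
    with eventually_inner_at_left[OF x]
    have "eventually (\<lambda>t. x \<in> inner_points t \<and> t \<in> {real_of_int ?n - 1<..<of_int ?n}) (at_left (of_int ?n))"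
      by eventually_elim blast
    then obtain t where t: "x \<in> inner_points t" "t \<in> {real_of_int ?n - 1<..<of_int ?n}"
      using eventually_happens[of _ "at_left (real_of_int ?n)"]
      by (auto simp: trivial_limit_at_left_real)
    have "?n \<ge> 1" using s by simp
    then have "real_of_int ?n \<ge> 1" by linarith
    then have t0: "t \<ge> 0" using t(2) unfolding greaterThanLessThan_iff by linarith
    have "\<lfloor>t\<rfloor> = ?n - 1" using t(2) by (simp add: floor_eq_iff)
    moreover have "x \<in> closed_points (of_int \<lfloor>t\<rfloor>)"
      using assms t0 t(1) inner_subset_closed unfolding semi_reflexive_iff_closed_points by blast
    ultimately have cl: "x \<in> closed_points (of_int ?n - 1)" by simp
    have "a h \<bullet> x < s * b h" if h: "h \<in> F" for h
    \<comment> \<open>A constraint with \<open>b h\<close> = 0 is the same at every dilation, so its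
      strictness comes from the dilate at the ceiling.\<close>
    proof (cases "b h = 0")
      case True
      then show ?thesis using x h by (auto simp: inner_points_def)
    next
      case False
      then have "b h > 0" using b_nonneg[OF h] by simp
      moreover have "of_int ?n - 1 < s" by linarith
      ultimately have "(of_int ?n - 1) * b h < s * b h" by simp
      moreover have "a h \<bullet> x \<le> (of_int ?n - 1) * b h" using cl h by (simp add: closed_points_def)
      ultimately show ?thesis by linarith
    qed
    then show "x \<in> inner_points s" using x by (simp add: inner_points_def)
  qed
qed

text \<open>The gauge of \<open>P\<close> is the maximum of the functionals \<open>a h \<bullet> x / b h\<close>, so along
  \<open>K x + w\<close> it is eventually affine in \<open>K\<close> with slope the gauge of \<open>x\<close>. Since \<open>w\<close> is in the
  relative interior of the cone over \<open>P\<close>, so are these points, hence their gauges are integers,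
  and so is the slope.\<close>
lemma ceiling_condition_imp_semi_reflexive:
  assumes "ceiling_condition P"
  shows "semi_reflexive P"
  unfolding semi_reflexive_iff_closed_points
proof (intro allI impI equalityI subsetI)
  fix s :: real and x assume s: "s \<ge> 0"
  let ?n = "\<lfloor>s\<rfloor>"
  show "x \<in> closed_points s" if "x \<in> closed_points (of_int ?n)"
    using that closed_points_mono[OF of_int_floor_le] by blast
  show "x \<in> closed_points (of_int ?n)" if x: "x \<in> closed_points s"
  proof (rule ccontr)
    assume nx: "x \<notin> closed_points (of_int ?n)"
    obtain m :: nat and w where m: "m > 0" and w: "w \<in> inner_points (real m)"
      by (rule rational_inner_point)
    \<comment> \<open>Constraints with \<open>b h\<close> = 0 only cut out the cone over
      \<open>P\<close>; the gauge is determined by those in \<open>H\<close>.\<close>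
    define H where "H = {h \<in> F. b h > 0}"
    define p q where "p h = a h \<bullet> x / b h" and "q h = a h \<bullet> w / b h" for h
    have xs: "a h \<bullet> x \<le> s * b h" if "h \<in> F" for h
      using x that by (simp add: closed_points_def)
    obtain h0 where h0: "h0 \<in> F" "a h0 \<bullet> x > of_int ?n * b h0"
      using nx x by (force simp: closed_points_def)
    \<comment> \<open>If \<open>b h0\<close> were 0, the violated and the satisfied inequality would
      have the same right-hand side.\<close>
    have "b h0 \<noteq> 0" using h0 xs[OF h0(1)] by auto
    then have h0H: "h0 \<in> H" using h0(1) b_nonneg[OF h0(1)] by (simp add: H_def)
    have "finite H" "H \<noteq> {}" using h0H finite_F by (auto simp: H_def)
    then obtain j where j: "j \<in> H" "\<And>i. i \<in> H \<Longrightarrow> p i \<le> p j"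
      and ev: "eventually (\<lambda>K::nat. \<forall>i\<in>H. K * p i + q i \<le> K * p j + q j) sequentially"
      by (rule eventually_max_affine[where p = p and q = q]) (rule that)
    have bpos: "b h > 0" if "h \<in> H" for h using that by (simp add: H_def)
    have "p h0 > of_int ?n" using h0(2) bpos[OF h0H] by (simp add: p_def divide_simps)
    then have lo: "p j > of_int ?n" using j(2)[OF h0H] by linarith
    have "p j \<le> s" using xs[of j] j(1) bpos[OF j(1)] by (simp add: p_def H_def divide_simps)
    \<comment> \<open>Now \<open>p j\<close> lies strictly between consecutive integers; it remains
      to show that it is an integer.\<close>
    then have hi: "p j < of_int ?n + 1" by linarith
    have pjpos: "p j > 0" using lo s by (smt (verit) zero_le_floor of_int_0_le_iff)
    have "eventually (\<lambda>K::nat. K * p j + q j > 0) sequentially"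
      using eventually_gt_at_top[of "nat \<lceil>- q j / p j\<rceil>"]
    proof eventually_elim
      case (elim K)
      then have "- q j / p j < real K" by linarith
      then show ?case using pjpos by (simp add: divide_simps)
    qed
    with ev have "eventually (\<lambda>K::nat. (\<forall>i\<in>H. K * p i + q i \<le> K * p j + q j)
        \<and> K * p j + q j > 0) sequentially"
      by eventually_elim blast
    moreover have "K * p j + q j \<in> \<int>"
      if K: "\<forall>i\<in>H. K * p i + q i \<le> K * p j + q j" "K * p j + q j > 0" for K :: nat
    proof (rule ccontr)
      \<comment> \<open>This is the gauge of \<open>y\<close>, attained at \<open>j\<close>. If it
        is no integer, \<open>y\<close> lies in the inner dilate at its ceiling, hence in the one at
        \<open>g\<close>, although constraint \<open>j\<close> is tight there.\<close>
      define g where "g = real K * p j + q j"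
      define y where "y = of_nat K *\<^sub>R x + w"
      assume "K * p j + q j \<notin> \<int>"
      then have "g \<noteq> of_int \<lceil>g\<rceil>" unfolding g_def by (metis Ints_of_int)
      then have less: "g < of_int \<lceil>g\<rceil>" using le_of_int_ceiling[of g] by linarith
      have y: "a h \<bullet> y = (real K * p h + q h) * b h" if "h \<in> H" for h
        using bpos[OF that] by (simp add: y_def p_def q_def inner_add_right field_simps)
      have "a h \<bullet> y < of_int \<lceil>g\<rceil> * b h" if h: "h \<in> F" for h
      proof (cases "h \<in> H")
        case True
        then have "real K * p h + q h < of_int \<lceil>g\<rceil>" using K(1) less by (fastforce simp: g_def)
        then show ?thesis using y[OF True] bpos[OF True] by simp
      next
        case False
        then have b0: "b h = 0" using b_nonneg[OF h] h by (simp add: H_def)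
        have "real K * (a h \<bullet> x) \<le> 0" using xs[OF h] b0 by (intro mult_nonneg_nonpos) auto
        \<comment> \<open>Here \<open>x\<close> gives only a weak inequality; adding
          \<open>w\<close> makes it strict.\<close>
        moreover have "a h \<bullet> w < 0" using w h b0 by (auto simp: inner_points_def)
        ultimately show ?thesis using b0 by (simp add: y_def inner_add_right)
      qed
      moreover have "y \<in> integer_points \<inter> affine hull P"
        unfolding y_def using x w
        by (auto simp: closed_points_def inner_points_def
            intro!: integer_points_add integer_points_scale_nat affine_hull_add affine_hull_scale)
      ultimately have "y \<in> inner_points (of_int \<lceil>g\<rceil>)" by (simp add: inner_points_def)
      then have "y \<in> inner_points g"
        using assms K(2) unfolding ceiling_condition_iff_inner_points g_def by blast
      then have "a j \<bullet> y < g * b j" using j(1) by (auto simp: inner_points_def H_def)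
      then show False using y[OF j(1)] by (simp add: g_def)
    qed
    ultimately have "eventually (\<lambda>K::nat. K * p j + q j \<in> \<int>) sequentially"
      by (auto elim: eventually_mono)
    then obtain K :: nat where K: "\<And>k. k \<ge> K \<Longrightarrow> real k * p j + q j \<in> \<int>"
      unfolding eventually_sequentially by blast
    have "K * p j + q j \<in> \<int>" "Suc K * p j + q j \<in> \<int>"
      using K[of K] K[of "Suc K"] by auto
    \<comment> \<open>Consecutive integral values differ by the slope \<open>p j\<close>.\<close>
    then have "(Suc K * p j + q j) - (K * p j + q j) \<in> \<int>" by (rule Ints_diff[rotated])
    then have "p j \<in> \<int>" by (simp add: algebra_simps)
    then obtain i where "p j = of_int i" by (auto elim: Ints_cases)
    then show False using lo hi by simp
  qed
qed

end

end

section \<open>The origin in a semi-reflexive polytope, and the equivalence\<close>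

text \<open>For small \<open>s\<close> > 0 the dilate lies in the open unit ball, where 0 is the
  only integer point, while rounding \<open>s\<close> down to 0 makes the count 1.\<close>

lemma semi_reflexive_zero_mem:
  fixes P :: "(real ^ 'd) set"
  assumes "semi_reflexive P"
  shows "0 \<in> P"
proof -
  have "bounded P"
    using assms by (simp add: semi_reflexive_def rational_polytope_def polytope_imp_bounded)
  then obtain B where B: "B > 0" "\<And>x. x \<in> P \<Longrightarrow> norm x \<le> B"
    using bounded_pos by blast
  define s where "s = 1 / (B + 1)"
  have s: "0 < s" "s < 1" "s * B < 1" using B(1) by (auto simp: s_def field_simps)
  then have "\<lfloor>s\<rfloor> = 0" by (simp add: floor_eq_iff)
  then have "lattice_count P s = 1"
    using assms s(1) unfolding semi_reflexive_def
    by (metis lattice_count_def less_imp_le of_int_0)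
  then have "card ((\<lambda>x. s *\<^sub>R x) ` P \<inter> integer_points) = 1" using s(1) by (simp add: lattice_count_def)
  then have "(\<lambda>x. s *\<^sub>R x) ` P \<inter> integer_points \<noteq> {}" by (metis card.empty zero_neq_one)
  then obtain p where p: "p \<in> P" "s *\<^sub>R p \<in> integer_points" by blast
  have "s * norm p \<le> s * B" using B(2)[OF p(1)] s(1) by simp
  then have "norm (s *\<^sub>R p) < 1" using s(3) abs_of_pos[OF s(1)] unfolding norm_scaleR by linarith
  then have "s *\<^sub>R p = 0" using integer_points_small_norm p(2) by blast
  then show ?thesis using p(1) s(1) by simp
qed

theorem theorem7:
  fixes P :: "(real ^ 'd) set"
  assumes "rational_polytope P"
    and "P \<noteq> {}"
  shows "semi_reflexive P \<longleftrightarrow>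
    (\<forall>s::real. s \<ge> 0 \<longrightarrow>
       lattice_count (rel_interior P) s = lattice_count (rel_interior P) (of_int \<lceil>s\<rceil>))"
proof -
  have "polyhedron P"
    using assms(1) by (simp add: rational_polytope_def polytope_imp_polyhedron)
  then obtain F :: "(real ^ 'd) set set" and a b where F: "finite F"
      "\<And>x. x \<in> P \<longleftrightarrow> x \<in> affine hull P \<and> (\<forall>h\<in>F. a h \<bullet> x \<le> b h)"
      "\<And>x. x \<in> rel_interior P \<longleftrightarrow> x \<in> affine hull P \<and> (\<forall>h\<in>F. a h \<bullet> x < b h)"
    by (rule polyhedron_halfspaces) (rule that)
  \<comment> \<open>The locale is available only once 0 is known to be in the affine hull, which
    each direction derives from its own hypothesis.\<close>
  have loc: "halfspace_polytope P F a b" if "0 \<in> affine hull P"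
    using assms that F by unfold_locales
  have "semi_reflexive P \<longleftrightarrow> ceiling_condition P"
  proof
    assume sr: "semi_reflexive P"
    then have "0 \<in> P" by (rule semi_reflexive_zero_mem)
    then show "ceiling_condition P"
      using halfspace_polytope.semi_reflexive_imp_ceiling_condition[OF loc] sr hull_inc by metis
  next
    assume cc: "ceiling_condition P"
    then have "0 \<in> affine hull P"
      using ceiling_condition_zero_mem_affine_hull assms by blast
    then have H: "halfspace_polytope P F a b" by (rule loc)
    then show "semi_reflexive P"
      using halfspace_polytope.ceiling_condition_zero_mem[OF H cc]
        halfspace_polytope.ceiling_condition_imp_semi_reflexive[OF H] cc by blast
  qed
  then show ?thesis by (simp add: ceiling_condition_def)
qed

end
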